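(* Let $N\ge1$ and $a,b\in\mathbb{R}$. For $u\in C_0^\infty(\mathbb{R}^N\setminus\{0\})$: (1) If $b+1-a>0$ and $b\leq\frac{N-2}{2}$, then $$\left(\int_{\mathbb{R}^N}\frac{|\nabla u|^2}{|x|^{2b}}dx\right)^{\frac12}\left(\int_{\mathbb{R}^N}\frac{|u|^2}{|x|^{2a}}dx\right)^{\frac12}\geq\left|\frac{N-a-b-1}{2}\right|\int_{\mathbb{R}^N}\frac{|u|^2}{|x|^{a+b+1}}dx.$$ Equality happens iff $u(x)=\alpha\exp\left(-\frac{\beta}{b+1-a}|x|^{b+1-a}\right)$ for some $\alpha\in\mathbb{R}$, $\beta>0$. (2) If $b+1-a<0$ and $b\geq\frac{N-2}{2}$, then $$\left(\int_{\mathbb{R}^N}\frac{|\nabla u|^2}{|x|^{2b}}dx\right)^{\frac12}\left(\int_{\mathbb{R}^N}\frac{|u|^2}{|x|^{2a}}dx\right)^{\frac12}\geq\left|\frac{a+b+1-N}{2}\right|\int_{\mathbb{R}^N}\frac{|u|^2}{|x|^{a+b+1}}dx.$$ Equality happens iff $u(x)=\alpha\exp\left(\frac{\beta}{b+1-a}|x|^{b+1-a}\right)$ for some $\alpha\in\mathbb{R}$, $\beta>0$. (3) If $b+1-a<0$ and $b\leq\frac{N-2}{2}$, then $$\left(\int_{\mathbb{R}^N}\frac{|\nabla u|^2}{|x|^{2b}}dx\right)^{\frac12}\left(\int_{\mathbb{R}^N}\frac{|u|^2}{|x|^{2a}}dx\right)^{\frac12}\geq\left|\frac{N-3b+a-3}{2}\right|\int_{\mathbb{R}^N}\frac{|u|^2}{|x|^{a+b+1}}dx.$$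 Equality happens iff $u(x)=\alpha|x|^{2b+2-N}\exp\left(\frac{\beta}{b+1-a}|x|^{b+1-a}\right)$ for some $\alpha\in\mathbb{R}$, $\beta>0$. (4) If $b+1-a>0$ and $b\geq\frac{N-2}{2}$, then $$\left(\int_{\mathbb{R}^N}\frac{|\nabla u|^2}{|x|^{2b}}dx\right)^{\frac12}\left(\int_{\mathbb{R}^N}\frac{|u|^2}{|x|^{2a}}dx\right)^{\frac12}\geq\left|\frac{N-3b+a-3}{2}\right|\int_{\mathbb{R}^N}\frac{|u|^2}{|x|^{a+b+1}}dx.$$ Equality happens iff $u(x)=\alpha|x|^{2b+2-N}\exp\left(-\frac{\beta}{b+1-a}|x|^{b+1-a}\right)$ for some $\alpha\in\mathbb{R}$, $\beta>0$.
   Context: $C_0^\infty(\mathbb{R}^N\setminus\{0\})$ is the space of real-valued smooth functions with compact support in $\mathbb{R}^N\setminus\{0\}$. *)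

theory Defs
  imports "HOL-Analysis.Analysis"
begin

(* All iterated directional derivatives of order at most k exist everywhere; the lower-order ones
   are differentiable and those of order k are continuous. *)
primrec Ck :: "nat \<Rightarrow> ('a::real_normed_vector \<Rightarrow> real) \<Rightarrow> bool" where
  "Ck 0 f \<longleftrightarrow> continuous_on UNIV f"
| "Ck (Suc k) f \<longleftrightarrow>
     (\<forall>x. f differentiable (at x)) \<and> (\<forall>v. Ck k (\<lambda>x. frechet_derivative f (at x) v))"

definition smooth :: "('a::real_normed_vector \<Rightarrow> real) \<Rightarrow> bool" where
  "smooth f \<longleftrightarrow> (\<forall>k. Ck k f)"

(* The usual space of test functions on an open set S, each one extended by zero outside S. *)
definition test_functions :: "'a::real_normed_vector set \<Rightarrow> ('a \<Rightarrow> real) set" where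
  "test_functions S =
     {u. smooth u \<and> compact (closure (support_on UNIV u)) \<and> closure (support_on UNIV u) \<subseteq> S}"

definition gradient :: "(real ^ 'n \<Rightarrow> real) \<Rightarrow> real ^ 'n \<Rightarrow> real ^ 'n" where
  "gradient u x = (\<chi> i. frechet_derivative u (at x) (axis i 1))"

lemma gderiv_gradient:
  fixes u :: "real ^ 'n \<Rightarrow> real"
  assumes "u differentiable (at x)"
  shows "GDERIV u x :> gradient u x"
proof -
  let ?D = "frechet_derivative u (at x)"
  have D: "(u has_derivative ?D) (at x)"
    using assms frechet_derivative_works by blast
  then have lin: "linear ?D"
    by (rule has_derivative_linear)
  have "?D h = inner h (gradient u x)" for h
  proof -
    have "?D h = ?D (\<Sum>i\<in>UNIV. (h $ i) *\<^sub>R axis i 1)"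
      using basis_expansion[of h] by (simp add: scalar_mult_eq_scaleR)
    also have "\<dots> = (\<Sum>i\<in>UNIV. (h $ i) * ?D (axis i 1))"
      by (simp add: linear_sum[OF lin] linear_cmul[OF lin])
    finally show ?thesis
      by (simp add: gradient_def inner_vec_def)
  qed
  then have "?D = (\<lambda>h. inner h (gradient u x))" ..
  then show ?thesis
    using D unfolding gderiv_def by metis
qed

(* In both integrals the exponent c is the full power of |x| in the denominator.
   The value of the integrand at x = 0 is irrelevant, {0} being a null set. *)
definition weighted_mass :: "real \<Rightarrow> (real ^ 'n \<Rightarrow> real) \<Rightarrow> real" where
  "weighted_mass c u = (LINT x|lborel. \<bar>u x\<bar>\<^sup>2 / norm x powr c)"

definition weighted_energy :: "real \<Rightarrow> (real ^ 'n \<Rightarrow> real) \<Rightarrow> real" where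
  "weighted_energy c u = (LINT x|lborel. (norm (gradient u x))\<^sup>2 / norm x powr c)"

end

theory Submission
  imports Defs
begin

text \<open>
  Write \<open>N\<close> for the dimension, \<open>E\<close> for the energy of weight \<open>2b\<close>, \<open>M\<close> and \<open>m\<close> for the masses of weight
  \<open>2a\<close> and \<open>a + b + 1\<close>.  For real \<open>t\<close> and \<open>s\<close> the integral of
  \<open>|\<nabla>u + (t |x| powr (b-a-1) + s |x| powr (-2)) u x|\<^sup>2 |x| powr (-2b)\<close> is nonnegative.
  Expanding the square leaves cross terms \<open>u (x \<bullet> \<nabla>u) |x| powr (-c)\<close>, which integrate to \<open>(c - N)/2\<close> times the mass of weight \<open>c\<close>
  (\<open>integral_weighted_radial_derivative\<close>).  If \<open>s = 0\<close> or \<open>s = N - 2 - 2b\<close>, all masses of weight \<open>2b + 2\<close>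
  cancel, and \<open>E + t\<^sup>2 M - t K m \<ge> 0\<close> remains, with \<open>K = N - a - b - 1 - 2s\<close>.  Minimising over \<open>t\<close> yields
  \<open>|K/2| m \<le> sqrt E * sqrt M\<close>.  The two values of \<open>s\<close> give the two constants of the theorem
  (\<open>weighted_uncertainty\<close>).

  If equality holds for a nonzero \<open>u\<close>, then \<open>M > 0\<close> and the square vanishes identically at the minimising
  \<open>t\<close>; so \<open>u\<close> solves a linear differential equation on every ray and, having compact support, is
  zero after all (\<open>radial_ode_vanishes\<close>).  The profiles in the equality
  clauses have no zero outside the origin, while \<open>u\<close> vanishes near the origin, so \<open>u\<close> has such a form
  only with \<open>\<alpha> = 0\<close> (\<open>nonvanishing_profile_iff_zero\<close>).  Both sides of each equality clause therefore say
  that \<open>u\<close> is zero.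

  The cross terms are computed without a divergence theorem: the integral of \<open>x \<bullet> \<nabla>w\<close> is read off from
  the scaling behaviour of the integral of \<open>w(c x)\<close> at \<open>c = 1\<close> (\<open>integral_radial_derivative\<close>).
\<close>

section \<open>Lebesgue integrals of continuous functions\<close>

lemma lborel_integral_scaleR:
  fixes w :: "'a::euclidean_space \<Rightarrow> real"
  assumes "0 < c" and [measurable]: "w \<in> borel_measurable borel"
  shows "(LINT x|lborel. w (c *\<^sub>R x)) = (LINT x|lborel. w x) / c ^ DIM('a)"
proof -
  have "(LINT x|lborel. w x) =
      (LINT x|density (distr lborel borel (\<lambda>x. 0 + c *\<^sub>R x)) (\<lambda>_. ennreal (\<bar>c\<bar> ^ DIM('a))). w x)"
    using lborel_affine[of c "0::'a"] assms(1) by simp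
  also have "\<dots> = c ^ DIM('a) * (LINT x|lborel. w (c *\<^sub>R x))"
    using assms(1) by (subst integral_density) (auto simp: integral_distr)
  finally show ?thesis
    using assms(1) by simp
qed

lemma integrable_compactly_supported:
  fixes f :: "'a::euclidean_space \<Rightarrow> real"
  assumes "continuous_on UNIV f" and "\<And>x. R < norm x \<Longrightarrow> f x = 0"
  shows "integrable lborel f"
proof -
  have "integrable lborel (\<lambda>x. indicator (cball 0 R) x *\<^sub>R f x)"
    by (intro borel_integrable_compact continuous_on_subset[OF assms(1)]) auto
  moreover have "(\<lambda>x. indicator (cball 0 R) x *\<^sub>R f x) = f"
    using assms(2) by (fastforce simp: indicator_def)
  ultimately show ?thesis by simp
qed

text \<open>
  An integral that vanishes gives only almost everywhere equality; since the zero set of a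
  continuous function is closed and a closed set of full measure is the whole space, it upgrades to
  equality at every point.
\<close>

lemma integral_nonneg_continuous_eq_0:
  fixes f :: "'a::euclidean_space \<Rightarrow> real"
  assumes int: "integrable lborel f" and cont: "continuous_on UNIV f"
    and nonneg: "\<And>x. 0 \<le> f x" and 0: "(LINT x|lborel. f x) = 0"
  shows "f x = 0"
proof -
  have "AE x in lborel. f x = 0"
    using integral_nonneg_eq_0_iff_AE[OF int] nonneg 0 by simp
  then have ae: "AE x in lebesgue. x \<in> {x. f x = 0}"
    by (simp add: AE_completion)
  have "closed {x. f x = 0}"
    using cont by (intro closed_Collect_eq) auto
  from mem_closed_if_AE_lebesgue[OF this ae] show ?thesis by simp
qed

section \<open>The integral of the radial derivative\<close>

lemma GDERIV_unique:
  fixes f :: "'a::real_inner \<Rightarrow> real"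
  assumes "GDERIV f x :> d" "GDERIV f x :> e"
  shows "d = e"
proof -
  have "(\<lambda>h. inner h d) = (\<lambda>h. inner h e)"
    using assms unfolding gderiv_def by (rule has_derivative_unique)
  then have "inner (d - e) d = inner (d - e) e"
    by meson
  then have "inner (d - e) (d - e) = 0"
    by (simp add: inner_diff_right)
  then show ?thesis by simp
qed

lemma GDERIV_zero_on_open:
  fixes f :: "'a::real_inner \<Rightarrow> real"
  assumes "open S" "x \<in> S" and "\<And>y. y \<in> S \<Longrightarrow> f y = 0"
  shows "GDERIV f x :> 0"
  using has_derivative_transform_within_open[OF has_derivative_const[of 0] assms(1,2), of f]
  by (simp add: gderiv_def assms(3))

text \<open>
  This replaces the divergence theorem for the field \<open>w(x) x\<close>.  Scaling gives
  \<open>\<integral> w(c x) dx = c powr (-N) \<integral> w\<close>, where \<open>N\<close> is the dimension, and the identity is the derivative of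
  both sides at \<open>c = 1\<close>.
\<close>

lemma integral_radial_derivative:
  fixes w :: "'a::euclidean_space \<Rightarrow> real"
  assumes G: "\<And>x. GDERIV w x :> G x" and contG: "continuous_on UNIV G"
    and supp: "\<And>x. R < norm x \<Longrightarrow> w x = 0"
  shows "(LINT x|lborel. inner x (G x)) = - real DIM('a) * (LINT x|lborel. w x)"
proof -
  \<comment> \<open>For scaling factors of at least 1/2 the rescaled functions live in the ball of radius 2R, so one
    box serves for the differentiation under the integral sign.\<close>
  obtain B :: 'a where B: "cball 0 (2 * R) \<subseteq> cbox (-B) B"
    using bounded_subset_cbox_symmetric[of "cball 0 (2 * R)"] by auto
  define U :: "real set" where "U = {1/2..2}"
  have contw: "continuous_on UNIV w"
    by (meson G gderiv_def continuous_at_imp_continuous_on has_derivative_continuous)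
  have G0: "G x = 0" if "R < norm x" for x
  proof (rule GDERIV_unique[OF G GDERIV_zero_on_open])
    show "open {y::'a. R < norm y}" by (intro open_Collect_less continuous_intros)
  qed (use that supp in auto)
  have R2: "R < norm (c *\<^sub>R x)" if "x \<notin> cbox (-B) B" "c \<in> U" for c x
  proof -
    have "2 * R < norm x"
      using B that(1) by (force simp: subset_iff)
    moreover have "1 / 2 * norm x \<le> c * norm x"
      using that(2) by (intro mult_right_mono) (auto simp: U_def)
    ultimately show ?thesis using that(2) by (auto simp: U_def)
  qed
  have box: "integral (cbox (-B) B) f = (LINT x|lborel. f x)"
    if "continuous_on UNIV f" "\<And>x. x \<notin> cbox (-B) B \<Longrightarrow> f x = 0" for f :: "'a \<Rightarrow> real"
  proof -
    have "integrable lborel (\<lambda>x. indicator (cbox (-B) B) x *\<^sub>R f x)"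
      by (intro borel_integrable_compact continuous_on_subset[OF that(1)]) auto
    moreover have "(\<lambda>x. indicator (cbox (-B) B) x *\<^sub>R f x) = f"
      using that(2) by (fastforce simp: indicator_def)
    ultimately have "integral UNIV f = (LINT x|lborel. f x)"
      by (simp add: integral_lborel)
    moreover have "(\<lambda>x. if x \<in> cbox (-B) B then f x else 0) = f"
      using that(2) by fastforce
    then have "integral UNIV f = integral (cbox (-B) B) f"
      using integral_restrict_UNIV[of "cbox (-B) B" f] by simp
    ultimately show ?thesis by simp
  qed
  have scaled: "integral (cbox (-B) B) (\<lambda>x. w (c *\<^sub>R x)) = (LINT x|lborel. w x) / c ^ DIM('a)"
    if "c \<in> U" for c
  proof -
    have "integral (cbox (-B) B) (\<lambda>x. w (c *\<^sub>R x)) = (LINT x|lborel. w (c *\<^sub>R x))"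
      using R2 supp that
      by (intro box continuous_on_compose2[OF contw]) (auto intro!: continuous_intros)
    also have "\<dots> = (LINT x|lborel. w x) / c ^ DIM('a)"
      using that contw
      by (intro lborel_integral_scaleR borel_measurable_continuous_onI) (auto simp: U_def)
    finally show ?thesis .
  qed
  have "((\<lambda>c. integral (cbox (-B) B) (\<lambda>x. w (c *\<^sub>R x))) has_field_derivative
      integral (cbox (-B) B) (\<lambda>x. inner x (G (1 *\<^sub>R x)))) (at 1 within U)"
  proof (rule leibniz_rule_field_derivative)
    fix c :: real and x :: 'a
    have "((\<lambda>c. c *\<^sub>R x) has_derivative (\<lambda>h. h *\<^sub>R x)) (at c within U)"
      by (auto intro!: derivative_eq_intros)
    moreover have "(w has_derivative (\<lambda>h. inner h (G (c *\<^sub>R x)))) (at (c *\<^sub>R x))"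
      using G by (simp add: gderiv_def)
    ultimately have "((\<lambda>c. w (c *\<^sub>R x)) has_derivative (\<lambda>h. inner (h *\<^sub>R x) (G (c *\<^sub>R x)))) (at c within U)"
      by (rule has_derivative_compose)
    then show "((\<lambda>c. w (c *\<^sub>R x)) has_field_derivative inner x (G (c *\<^sub>R x))) (at c within U)"
      by (simp add: has_field_derivative_def mult_commute_abs)
  next
    show "(\<lambda>x. w (c *\<^sub>R x)) integrable_on cbox (-B) B" for c
      by (intro integrable_continuous continuous_on_compose2[OF contw]) (auto intro!: continuous_intros)
    show "continuous_on (U \<times> cbox (-B) B) (\<lambda>(c, x). inner x (G (c *\<^sub>R x)))"
      unfolding case_prod_beta
      by (intro continuous_intros continuous_on_compose2[OF contG]) auto
  qed (auto simp: U_def)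
  then have "((\<lambda>c. (LINT x|lborel. w x) / c ^ DIM('a)) has_field_derivative
      integral (cbox (-B) B) (\<lambda>x. inner x (G x))) (at 1 within U)"
    unfolding scaleR_one
    by (rule has_field_derivative_transform_within[where d = 1]) (auto simp: scaled U_def)
  moreover have "at 1 within U = at 1"
    by (rule at_within_interior) (simp add: U_def)
  moreover have "((\<lambda>c::real. (LINT x|lborel. w x) / c ^ DIM('a)) has_field_derivative
      - real DIM('a) * (LINT x|lborel. w x)) (at 1)"
    by (auto intro!: derivative_eq_intros)
  ultimately have "integral (cbox (-B) B) (\<lambda>x. inner x (G x)) = - real DIM('a) * (LINT x|lborel. w x)"
    using DERIV_unique by fastforce
  moreover have "integral (cbox (-B) B) (\<lambda>x. inner x (G x)) = (LINT x|lborel. inner x (G x))"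
    using R2[of _ 1] G0 by (intro box continuous_intros contG) (auto simp: U_def)
  ultimately show ?thesis by simp
qed

section \<open>Functions supported in an annulus\<close>

lemma test_function_annulus:
  assumes "u \<in> test_functions (UNIV - {0})"
  obtains \<epsilon> R where "0 < \<epsilon>" "\<And>x. norm x < \<epsilon> \<or> R < norm x \<Longrightarrow> u x = 0"
proof -
  let ?K = "closure (support_on UNIV u)"
  have K: "compact ?K" "0 \<notin> ?K"
    using assms by (auto simp: test_functions_def)
  then have "open (- ?K)" "0 \<in> - ?K" by auto
  then obtain \<epsilon> where \<epsilon>: "0 < \<epsilon>" "ball 0 \<epsilon> \<subseteq> - ?K"
    by (meson open_contains_ball)
  obtain R where R: "\<And>x. x \<in> ?K \<Longrightarrow> norm x \<le> R"
    using compact_imp_bounded[OF K(1)] by (auto simp: bounded_iff)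
  have supp: "x \<in> ?K" if "u x \<noteq> 0" for x
    using that closure_subset[of "support_on UNIV u"] by (auto simp: in_support_on)
  show thesis
  proof (rule that[OF \<epsilon>(1)])
    show "u x = 0" if "norm x < \<epsilon> \<or> R < norm x" for x
      using that supp[of x] \<epsilon>(2) R[of x] by (force simp: subset_iff)
  qed
qed

lemma smooth_gradient:
  fixes u :: "real ^ 'n \<Rightarrow> real"
  assumes "smooth u"
  shows "GDERIV u x :> gradient u x" and "continuous_on UNIV (gradient u)"
proof -
  have 1: "Ck 1 u"
    using assms by (simp add: smooth_def)
  then show "GDERIV u x :> gradient u x"
    by (intro gderiv_gradient) simp
  show "continuous_on UNIV (gradient u)"
    unfolding gradient_def using 1 by (intro continuous_on_vec_lambda) simp
qed

text \<open>
  The class of functions all integrands belong to.  Vanishing near the origin makes every power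
  of the norm, positive or negative, a harmless weight; vanishing far out gives integrability.
  Closure under weights is expressed by \<open>annular_combine\<close>.
\<close>

definition annular :: "('a::real_normed_vector \<Rightarrow> 'b::real_normed_vector) \<Rightarrow> bool" where
  "annular f \<longleftrightarrow> continuous_on (- {0}) f \<and>
     (\<exists>\<epsilon> R. 0 < \<epsilon> \<and> (\<forall>x. norm x < \<epsilon> \<or> R < norm x \<longrightarrow> f x = 0))"

lemma annular_continuous:
  assumes "annular f"
  shows "continuous_on UNIV f"
proof -
  obtain \<epsilon> where cont: "continuous_on (- {0}) f"
    and \<epsilon>: "0 < \<epsilon>" "\<And>x. norm x < \<epsilon> \<Longrightarrow> f x = 0"
    using assms by (auto simp: annular_def)
  have "continuous_on (ball 0 \<epsilon>) f"
    by (rule continuous_on_eq[OF continuous_on_const[of _ 0]]) (simp add: \<epsilon>(2))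
  then have "continuous_on (ball 0 \<epsilon> \<union> - {0}) f"
    using cont by (intro continuous_on_open_Un) auto
  moreover have "ball 0 \<epsilon> \<union> - {0::'a} = UNIV"
    using \<epsilon>(1) by auto
  ultimately show ?thesis by simp
qed

lemma annular_zero: "annular f \<Longrightarrow> f 0 = 0"
  by (auto simp: annular_def)

lemma annular_integrable:
  fixes f :: "'a::euclidean_space \<Rightarrow> real"
  assumes "annular f"
  shows "integrable lborel f"
proof -
  obtain R where "\<And>x. R < norm x \<Longrightarrow> f x = 0"
    using assms by (auto simp: annular_def)
  then show ?thesis
    using annular_continuous[OF assms] by (rule integrable_compactly_supported[rotated])
qed

lemma annular_combine:
  assumes f: "annular f" and g: "continuous_on (- {0}) g"
    and "\<And>x. f x = 0 \<Longrightarrow> g x = 0"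
  shows "annular g"
  using assms unfolding annular_def by metis

lemma annular_Pair:
  assumes "annular f" "annular g"
  shows "annular (\<lambda>x. (f x, g x))"
proof -
  obtain \<epsilon>1 R1 where f: "continuous_on (- {0}) f" "0 < \<epsilon>1" "\<And>x. norm x < \<epsilon>1 \<or> R1 < norm x \<Longrightarrow> f x = 0"
    using assms(1) unfolding annular_def by blast
  obtain \<epsilon>2 R2 where g: "continuous_on (- {0}) g" "0 < \<epsilon>2" "\<And>x. norm x < \<epsilon>2 \<or> R2 < norm x \<Longrightarrow> g x = 0"
    using assms(2) unfolding annular_def by blast
  have "(f x, g x) = 0" if "norm x < min \<epsilon>1 \<epsilon>2 \<or> max R1 R2 < norm x" for x
    using f(3)[of x] g(3)[of x] that by (auto simp: zero_prod_def)
  then show ?thesis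
    unfolding annular_def using f(1,2) g(1,2)
    by (intro conjI continuous_intros exI[of _ "min \<epsilon>1 \<epsilon>2"] exI[of _ "max R1 R2"]) auto
qed

lemma annular_gradient:
  fixes u :: "'a::real_inner \<Rightarrow> real"
  assumes G: "\<And>x. GDERIV u x :> G x" and u: "annular u" and contG: "continuous_on (- {0}) G"
  shows "annular G"
proof -
  obtain \<epsilon> R where \<epsilon>: "0 < \<epsilon>" "\<And>x. norm x < \<epsilon> \<or> R < norm x \<Longrightarrow> u x = 0"
    using u by (auto simp: annular_def)
  have "G x = 0" if "norm x < \<epsilon> \<or> R < norm x" for x
  proof (rule GDERIV_unique[OF G GDERIV_zero_on_open])
    show "open ({x. norm x < \<epsilon>} \<union> {x. R < norm x})"
      by (intro open_Un open_Collect_less continuous_intros)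
  qed (use that \<epsilon>(2) in auto)
  then show ?thesis
    using contG \<epsilon>(1) unfolding annular_def by blast
qed

section \<open>Weighted integration by parts\<close>

text \<open>
  The radial identity applied to \<open>w = u\<^sup>2 |x| powr (-c)\<close>: differentiating the weight along \<open>x\<close> reproduces
  \<open>w\<close> with the factor \<open>-c\<close>, which shifts the dimension in the constant.
\<close>

lemma integral_weighted_radial_derivative:
  fixes u :: "'a::euclidean_space \<Rightarrow> real"
  assumes G: "\<And>x. GDERIV u x :> G x" and contG: "continuous_on UNIV G" and u: "annular u"
  shows "2 * (LINT x|lborel. u x * inner x (G x) / norm x powr c) =
    (c - DIM('a)) * (LINT x|lborel. (u x)\<^sup>2 / norm x powr c)"
proof -
  define w where "w = (\<lambda>x. (u x)\<^sup>2 / norm x powr c)"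
  define H where "H = (\<lambda>x. (2 * u x / norm x powr c) *\<^sub>R G x - (c * (u x)\<^sup>2 / norm x powr (c + 2)) *\<^sub>R x)"
  obtain \<epsilon> R where \<epsilon>: "0 < \<epsilon>" "\<And>x. norm x < \<epsilon> \<or> R < norm x \<Longrightarrow> u x = 0"
    using u by (auto simp: annular_def)
  have contu: "continuous_on (- {0}) u"
    using u by (simp add: annular_def)
  note contG' = continuous_on_subset[OF contG subset_UNIV]
  have "annular H"
    unfolding H_def
    by (rule annular_combine[OF u]) (auto intro!: continuous_intros contu contG')
  have "GDERIV w x :> H x" for x
  proof (cases "x = 0")
    case True
    \<comment> \<open>The norm is not differentiable at the origin, but \<open>w\<close> vanishes around it.\<close>
    have "GDERIV w x :> 0"
      by (rule GDERIV_zero_on_open[of "ball 0 \<epsilon>"]) (use True \<epsilon> in \<open>auto simp: w_def\<close>)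
    then show ?thesis
      using annular_zero[OF \<open>annular H\<close>] True by simp
  next
    case False
    have "(u has_derivative (\<lambda>h. inner h (G x))) (at x)"
      using G by (simp add: gderiv_def)
    moreover have "norm x powr (c + 2) = norm x powr c * norm x * norm x"
      using False by (simp add: powr_add power2_eq_square)
    ultimately show ?thesis
      using False unfolding gderiv_def w_def H_def
      by (auto intro!: derivative_eq_intros has_derivative_norm
          simp: fun_eq_iff inner_diff_right sgn_div_norm power2_eq_square field_simps)
  qed
  then have eq: "(LINT x|lborel. inner x (H x)) = - real DIM('a) * (LINT x|lborel. w x)"
    using annular_continuous[OF \<open>annular H\<close>]
    by (rule integral_radial_derivative[where R = R]) (simp add: w_def \<epsilon>(2))
  have "inner x (H x) = 2 * (u x * inner x (G x) / norm x powr c) - c * w x" for x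
  proof (cases "x = 0")
    case False
    then have "norm x powr (c + 2) = norm x powr c * inner x x"
      by (simp add: powr_add power2_norm_eq_inner)
    then show ?thesis
      using False by (simp add: H_def w_def inner_diff_right)
  qed (simp add: w_def)
  then have "(LINT x|lborel. inner x (H x)) =
      (LINT x|lborel. 2 * (u x * inner x (G x) / norm x powr c) - c * w x)"
    by presburger
  also have "\<dots> = 2 * (LINT x|lborel. u x * inner x (G x) / norm x powr c) - c * (LINT x|lborel. w x)"
  proof (subst Bochner_Integration.integral_diff)
    have "integrable lborel w"
      unfolding w_def
      by (intro annular_integrable annular_combine[OF u]) (auto intro!: continuous_intros contu)
    then show "integrable lborel (\<lambda>x. c * w x)" by simp
    have "integrable lborel (\<lambda>x. u x * inner x (G x) / norm x powr c)"
      by (intro annular_integrable annular_combine[OF u]) (auto intro!: continuous_intros contu contG')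
    then show "integrable lborel (\<lambda>x. 2 * (u x * inner x (G x) / norm x powr c))"
      by (rule integrable_mult_right)
  qed (simp only: integral_mult_right_zero)
  finally have "(LINT x|lborel. inner x (H x)) =
      2 * (LINT x|lborel. u x * inner x (G x) / norm x powr c) - c * (LINT x|lborel. w x)" .
  with eq show ?thesis
    by (simp add: w_def algebra_simps)
qed

section \<open>Completing the square\<close>

text \<open>
  On the ray through \<open>x\<close> the function solves a scalar linear equation \<open>g' = h g\<close> with \<open>h\<close> continuous.
  With \<open>H\<close> an antiderivative of \<open>h\<close>, the product \<open>g exp(-H)\<close> is constant, and it is zero once the ray
  has left the support.
\<close>

lemma radial_ode_vanishes:
  fixes u :: "'a::real_inner \<Rightarrow> real"
  assumes G: "\<And>x. GDERIV u x :> G x"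
    and ode: "\<And>x. x \<noteq> 0 \<Longrightarrow> G x = (q x * u x) *\<^sub>R x"
    and q: "continuous_on (- {0}) q"
    and supp: "\<And>x. R < norm x \<Longrightarrow> u x = 0" and "x \<noteq> 0"
  shows "u x = 0"
proof -
  define T where "T = max 1 ((R + 1) / norm x)"
  have "R + 1 \<le> T * norm x"
    using \<open>x \<noteq> 0\<close> by (simp add: T_def pos_divide_le_eq[symmetric])
  moreover have T: "1 \<le> T"
    by (simp add: T_def)
  ultimately have end0: "u (T *\<^sub>R x) = 0"
    by (intro supp) simp
  define h where "h = (\<lambda>r. q (r *\<^sub>R x) * r * inner x x)"
  have "continuous_on {1..T} h"
    unfolding h_def using \<open>x \<noteq> 0\<close>
    by (intro continuous_intros continuous_on_compose2[OF q]) auto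
  then obtain H where H: "\<And>r. r \<in> {1..T} \<Longrightarrow> (H has_vector_derivative h r) (at r within {1..T})"
    by (rule antiderivative_continuous) blast
  \<comment> \<open>\<open>exp (- H)\<close> is the integrating factor.\<close>
  have "((\<lambda>r. u (r *\<^sub>R x) * exp (- H r)) has_field_derivative 0) (at r within {1..T})"
    if r: "r \<in> {1..T}" for r
  proof -
    have "((\<lambda>r. r *\<^sub>R x) has_derivative (\<lambda>k. k *\<^sub>R x)) (at r within {1..T})"
      by (auto intro!: derivative_eq_intros)
    moreover have "(u has_derivative (\<lambda>k. inner k (G (r *\<^sub>R x)))) (at (r *\<^sub>R x))"
      using G by (simp add: gderiv_def)
    ultimately have "((\<lambda>r. u (r *\<^sub>R x)) has_derivative (\<lambda>k. inner (k *\<^sub>R x) (G (r *\<^sub>R x)))) (at r within {1..T})"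
      by (rule has_derivative_compose)
    moreover have "(\<lambda>k. inner (k *\<^sub>R x) (G (r *\<^sub>R x))) = (*) (h r * u (r *\<^sub>R x))"
      using r \<open>x \<noteq> 0\<close> by (simp add: ode h_def fun_eq_iff mult_ac)
    ultimately have "((\<lambda>r. u (r *\<^sub>R x)) has_field_derivative h r * u (r *\<^sub>R x)) (at r within {1..T})"
      by (simp add: has_field_derivative_def)
    moreover have "(H has_field_derivative h r) (at r within {1..T})"
      using H[OF r] by (simp add: has_real_derivative_iff_has_vector_derivative)
    ultimately show ?thesis
      by (auto intro!: derivative_eq_intros simp: algebra_simps)
  qed
  then have "\<exists>k. \<forall>r\<in>{1..T}. u (r *\<^sub>R x) * exp (- H r) = k"
    by (intro has_field_derivative_zero_constant) auto
  then obtain k where k: "\<And>r. r \<in> {1..T} \<Longrightarrow> u (r *\<^sub>R x) * exp (- H r) = k"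
    by blast
  from k[of T] T end0 have "k = 0" by simp
  with k[of 1] T show ?thesis by simp
qed

text \<open>
  The powers are matched so that, after division by \<open>|x| powr (2b)\<close>, the \<open>t\<close>-part of the perturbation
  produces the masses with weights \<open>2a\<close> and \<open>a + b + 1\<close>, and the \<open>s\<close>-part only the Hardy weight
  \<open>2b + 2\<close> besides.  At the origin all terms are zero, by the conventions for division by zero.
\<close>

lemma norm_perturbed_gradient_sq:
  fixes x g :: "'a::real_inner" and v :: real
  shows "(norm (g + ((t * norm x powr (b - a - 1) + s * norm x powr (- 2)) * v) *\<^sub>R x))\<^sup>2 / norm x powr (2 * b) =
      (norm g)\<^sup>2 / norm x powr (2 * b)
    + 2 * t * (v * inner x g / norm x powr (a + b + 1))
    + 2 * s * (v * inner x g / norm x powr (2 * b + 2))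
    + t\<^sup>2 * (v\<^sup>2 / norm x powr (2 * a))
    + 2 * t * s * (v\<^sup>2 / norm x powr (a + b + 1))
    + s\<^sup>2 * (v\<^sup>2 / norm x powr (2 * b + 2))"
proof (cases "x = 0")
  case False
  define r A B where "r = norm x" and "A = norm x powr a" and "B = norm x powr b"
  have pos: "0 < r" "0 < A" "0 < B"
    using False by (auto simp: r_def A_def B_def)
  have double: "r powr (2 * c) = (r powr c)\<^sup>2" for c
    by (metis powr_add power2_eq_square mult_2)
  have powrs: "r powr (b - a - 1) = B / (A * r)" "r powr (- 2) = 1 / r\<^sup>2" "r powr (2 * b) = B\<^sup>2"
    "r powr (a + b + 1) = A * B * r" "r powr (2 * b + 2) = B\<^sup>2 * r\<^sup>2" "r powr (2 * a) = A\<^sup>2"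
    using pos unfolding A_def B_def r_def[symmetric]
    by (simp_all add: powr_diff powr_add powr_minus_divide double)
  have "(norm (g + (p * v) *\<^sub>R x))\<^sup>2 = (norm g)\<^sup>2 + 2 * p * v * inner x g + p\<^sup>2 * v\<^sup>2 * r\<^sup>2" for p
    unfolding power2_norm_eq_inner r_def
    by (simp add: inner_add inner_commute power2_eq_square algebra_simps)
  moreover define p where "p = t * (B / (A * r)) + s * (1 / r\<^sup>2)"
  moreover have "p / B\<^sup>2 = t * (1 / (A * B * r)) + s * (1 / (B\<^sup>2 * r\<^sup>2))"
    using pos by (simp add: p_def field_simps power2_eq_square)
  moreover have "p\<^sup>2 * r\<^sup>2 / B\<^sup>2 = t\<^sup>2 * (1 / A\<^sup>2) + 2 * t * s * (1 / (A * B * r)) + s\<^sup>2 * (1 / (B\<^sup>2 * r\<^sup>2))"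
  proof -
    have "p * r / B = t / A + s / (B * r)"
      using pos by (simp add: p_def field_simps power2_eq_square)
    then have "(p * r / B)\<^sup>2 = (t / A + s / (B * r))\<^sup>2" by simp
    then show ?thesis
      by (simp add: power2_sum power_divide power_mult_distrib mult_ac)
  qed
  moreover have "(G + 2 * p * v * I + p\<^sup>2 * v\<^sup>2 * r\<^sup>2) / B\<^sup>2 = G / B\<^sup>2 + 2 * v * I * (p / B\<^sup>2) + v\<^sup>2 * (p\<^sup>2 * r\<^sup>2 / B\<^sup>2)"
    for G I
    by (simp add: add_divide_distrib mult_ac)
  ultimately have "(norm (g + (p * v) *\<^sub>R x))\<^sup>2 / B\<^sup>2 = (norm g)\<^sup>2 / B\<^sup>2
      + 2 * v * inner x g * (t * (1 / (A * B * r)) + s * (1 / (B\<^sup>2 * r\<^sup>2)))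
      + v\<^sup>2 * (t\<^sup>2 * (1 / A\<^sup>2) + 2 * t * s * (1 / (A * B * r)) + s\<^sup>2 * (1 / (B\<^sup>2 * r\<^sup>2)))"
    by simp
  then show ?thesis
    unfolding r_def[symmetric] powrs p_def by (simp add: distrib_left mult_ac)
qed simp

text \<open>
  Integrating the square of \<open>F t = \<nabla>u + (t |x| powr (b-a-1) + s |x| powr (-2)) u x\<close> against \<open>|x| powr (-2b)\<close> gives
  \<open>E + t\<^sup>2 M - t K m + s (s - (N-2-2b)) h\<close>, with \<open>h\<close> the mass of weight \<open>2b + 2\<close>.  The two admitted
  values of \<open>s\<close> are the roots that remove the Hardy term.  What is left is a nonnegative quadratic
  polynomial in \<open>t\<close>, and its minimum is the inequality.  A minimum equal to zero
  would force \<open>F t = 0\<close>, a linear equation on rays, whose only annular solution is zero.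
\<close>

lemma weighted_uncertainty:
  fixes u :: "real ^ 'n \<Rightarrow> real" and a b s K :: real
  assumes u: "u \<in> test_functions (UNIV - {0})"
    and s: "s = 0 \<or> s = real CARD('n) - 2 - 2 * b"
    and K: "K = real CARD('n) - a - b - 1 - 2 * s"
  defines "lhs \<equiv> sqrt (weighted_energy (2 * b) u) * sqrt (weighted_mass (2 * a) u)"
    and "rhs \<equiv> \<bar>K / 2\<bar> * weighted_mass (a + b + 1) u"
  shows "rhs \<le> lhs" and "lhs = rhs \<longleftrightarrow> u = (\<lambda>x. 0)"
proof -
  have "smooth u"
    using u by (simp add: test_functions_def)
  note G = smooth_gradient[OF this]
  have contu: "continuous_on S u" for S
    using G(1) unfolding gderiv_def
    by (intro continuous_at_imp_continuous_on ballI) (rule has_derivative_continuous)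
  note contG = continuous_on_subset[OF G(2) subset_UNIV]
  obtain \<epsilon> R where \<epsilon>: "0 < \<epsilon>" "\<And>x. norm x < \<epsilon> \<or> R < norm x \<Longrightarrow> u x = 0"
    using test_function_annulus[OF u] by blast
  have ann: "annular u"
    using \<epsilon> contu unfolding annular_def by blast
  have annG: "annular (gradient u)"
    by (rule annular_gradient[OF G(1) ann contG])
  define E M m where "E = weighted_energy (2 * b) u" and "M = weighted_mass (2 * a) u"
    and "m = weighted_mass (a + b + 1) u"
  have int_mass: "integrable lborel (\<lambda>x. (u x)\<^sup>2 / norm x powr c)" for c
    by (intro annular_integrable annular_combine[OF ann]) (auto intro!: continuous_intros contu)
  have int_energy: "integrable lborel (\<lambda>x. (norm (gradient u x))\<^sup>2 / norm x powr c)" for c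
    by (intro annular_integrable annular_combine[OF annG]) (auto intro!: continuous_intros contG)
  have int_cross: "integrable lborel (\<lambda>x. u x * inner x (gradient u x) / norm x powr c)" for c
    by (intro annular_integrable annular_combine[OF ann]) (auto intro!: continuous_intros contu contG)
  have cross: "2 * (LINT x|lborel. u x * inner x (gradient u x) / norm x powr c) =
      (c - real CARD('n)) * weighted_mass c u" for c
    using integral_weighted_radial_derivative[OF G ann, of c] by (simp add: weighted_mass_def)
  define F where "F = (\<lambda>t x. gradient u x
    + ((t * norm x powr (b - a - 1) + s * norm x powr (- 2)) * u x) *\<^sub>R x)"
  have annF: "annular (\<lambda>x. (norm (F t x))\<^sup>2 / norm x powr (2 * b))" for t
  proof -
    show ?thesis
      by (rule annular_combine[OF annular_Pair[OF ann annG]])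
         (auto intro!: continuous_intros contu contG simp: F_def zero_prod_def)
  qed
  have square: "(LINT x|lborel. (norm (F t x))\<^sup>2 / norm x powr (2 * b)) = E + t\<^sup>2 * M - t * K * m" for t
  proof -
    let ?X = "\<lambda>c. LINT x|lborel. u x * inner x (gradient u x) / norm x powr c"
    have "(LINT x|lborel. (norm (F t x))\<^sup>2 / norm x powr (2 * b)) =
        E + 2 * t * ?X (a + b + 1) + 2 * s * ?X (2 * b + 2) + t\<^sup>2 * M + 2 * t * s * m
        + s\<^sup>2 * weighted_mass (2 * b + 2) u"
      unfolding F_def norm_perturbed_gradient_sq E_def M_def m_def weighted_mass_def weighted_energy_def
      by (simp add: int_mass int_energy int_cross del: times_divide_eq_right)
    also have "2 * t * ?X (a + b + 1) = t * ((a + b + 1 - real CARD('n)) * m)"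
      using cross[of "a + b + 1"] by (simp add: m_def mult_ac)
    also have "2 * s * ?X (2 * b + 2) = s * ((2 * b + 2 - real CARD('n)) * weighted_mass (2 * b + 2) u)"
      using cross[of "2 * b + 2"] by (simp add: mult_ac)
    finally have "(LINT x|lborel. (norm (F t x))\<^sup>2 / norm x powr (2 * b)) =
        E + t\<^sup>2 * M - t * K * m + s * (s - (real CARD('n) - 2 - 2 * b)) * weighted_mass (2 * b + 2) u"
      unfolding K by (simp add: algebra_simps power2_eq_square)
    with s show ?thesis by auto
  qed
  have nonneg: "0 \<le> E" "0 \<le> M" "0 \<le> m"
    by (simp_all add: E_def M_def m_def weighted_energy_def weighted_mass_def)
  have lhs2: "lhs\<^sup>2 = E * M" and rhs2: "rhs\<^sup>2 = K\<^sup>2 * m\<^sup>2 / 4"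
    using nonneg by (simp_all add: lhs_def rhs_def E_def M_def m_def power_mult_distrib power_divide)
  have pos: "0 \<le> lhs" "0 \<le> rhs"
    using nonneg by (simp_all add: lhs_def rhs_def E_def M_def m_def)
  have trivial: "lhs = rhs" if "u = (\<lambda>x. 0)"
    using that by (simp add: lhs_def rhs_def weighted_mass_def)
  have strict: "rhs < lhs" if nz: "u \<noteq> (\<lambda>x. 0)"
  proof -
    from nz obtain z where z: "u z \<noteq> 0" by auto
    then have "z \<noteq> 0"
      using \<epsilon> by auto
    have "M \<noteq> 0"
    proof
      assume "M = 0"
      have "annular (\<lambda>x. (u x)\<^sup>2 / norm x powr (2 * a))"
        by (intro annular_combine[OF ann]) (auto intro!: continuous_intros contu)
      then have "(u z)\<^sup>2 / norm z powr (2 * a) = 0"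
        using \<open>M = 0\<close> int_mass[of "2 * a"]
        by (intro integral_nonneg_continuous_eq_0[where f = "\<lambda>x. (u x)\<^sup>2 / norm x powr (2 * a)"]
            annular_continuous) (auto simp: M_def weighted_mass_def)
      with z \<open>z \<noteq> 0\<close> show False by simp
    qed
    with nonneg have "0 < M" by simp
    \<comment> \<open>The minimiser of the quadratic polynomial.\<close>
    define t where "t = K * m / (2 * M)"
    have "E + t\<^sup>2 * M - t * K * m \<noteq> 0"
    proof
      assume *: "E + t\<^sup>2 * M - t * K * m = 0"
      have F0: "(norm (F t x))\<^sup>2 / norm x powr (2 * b) = 0" for x
        using * square[of t] annF[of t]
        by (intro integral_nonneg_continuous_eq_0[where f = "\<lambda>x. (norm (F t x))\<^sup>2 / norm x powr (2 * b)"]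
            annular_continuous annular_integrable) auto
      have ode: "gradient u x = (- (t * norm x powr (b - a - 1) + s * norm x powr (- 2)) * u x) *\<^sub>R x"
        if "x \<noteq> 0" for x
      proof -
        have "F t x = 0"
          using F0[of x] that by simp
        then show ?thesis
          unfolding F_def mult_minus_left scaleR_minus_left by (simp only: eq_neg_iff_add_eq_0)
      qed
      have "u z = 0"
        by (rule radial_ode_vanishes[OF G(1) ode])
           (use \<epsilon>(2) \<open>z \<noteq> 0\<close> in \<open>auto intro!: continuous_intros\<close>)
      with z show False by simp
    qed
    moreover have "0 \<le> (LINT x|lborel. (norm (F t x))\<^sup>2 / norm x powr (2 * b))"
      by simp
    ultimately have "0 < (E + t\<^sup>2 * M - t * K * m) * M"
      using square[of t] \<open>0 < M\<close> by simp
    also have "\<dots> = E * M - K\<^sup>2 * m\<^sup>2 / 4"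
      using \<open>0 < M\<close> by (simp add: t_def field_simps power2_eq_square)
    finally have "rhs\<^sup>2 < lhs\<^sup>2"
      by (simp add: lhs2 rhs2)
    then show ?thesis
      using pos by (simp add: power2_less_imp_less)
  qed
  show "rhs \<le> lhs" "lhs = rhs \<longleftrightarrow> u = (\<lambda>x. 0)"
    using strict trivial by fastforce+
qed

section \<open>The weighted uncertainty inequalities\<close>

text \<open>
  The extremal profiles vanish nowhere outside the origin, whereas a test function vanishes near
  the origin; so a test function can be a multiple of a profile only with coefficient zero.
\<close>

lemma nonvanishing_profile_iff_zero:
  fixes u :: "real ^ 'n \<Rightarrow> real" and \<phi> :: "real \<Rightarrow> real ^ 'n \<Rightarrow> real"
  assumes u: "u \<in> test_functions (UNIV - {0})" and \<phi>: "\<And>\<beta> x. x \<noteq> 0 \<Longrightarrow> \<phi> \<beta> x \<noteq> 0"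
  shows "u = (\<lambda>x. 0) \<longleftrightarrow> (\<exists>\<alpha> \<beta>. \<beta> > 0 \<and> (\<forall>x. x \<noteq> 0 \<longrightarrow> u x = \<alpha> * \<phi> \<beta> x))"
proof
  assume "u = (\<lambda>x. 0)"
  then show "\<exists>\<alpha> \<beta>. \<beta> > 0 \<and> (\<forall>x. x \<noteq> 0 \<longrightarrow> u x = \<alpha> * \<phi> \<beta> x)"
    by (intro exI[of _ 0] exI[of _ 1]) simp
next
  assume "\<exists>\<alpha> \<beta>. \<beta> > 0 \<and> (\<forall>x. x \<noteq> 0 \<longrightarrow> u x = \<alpha> * \<phi> \<beta> x)"
  then obtain \<alpha> \<beta> where eq: "\<And>x. x \<noteq> 0 \<Longrightarrow> u x = \<alpha> * \<phi> \<beta> x" by blast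
  obtain \<epsilon> R where \<epsilon>: "0 < \<epsilon>" "\<And>x. norm x < \<epsilon> \<or> R < norm x \<Longrightarrow> u x = 0"
    using test_function_annulus[OF u] by blast
  obtain y :: "real ^ 'n" where y: "norm y = \<epsilon> / 2"
    using vector_choose_size[of "\<epsilon> / 2"] \<epsilon>(1) by auto
  then have "y \<noteq> 0" "u y = 0"
    using \<epsilon> by auto
  then have "\<alpha> = 0"
    using eq[of y] \<phi>[of y \<beta>] by simp
  then have "u x = 0" for x
    using eq[of x] \<epsilon> by (cases "x = 0") auto
  then show "u = (\<lambda>x. 0)" by blast
qed

theorem corollary1p1:
  fixes u :: "real ^ 'n \<Rightarrow> real" and a b N :: real
  defines "N \<equiv> real CARD('n)"
  assumes u: "u \<in> test_functions (UNIV - {0})"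
  shows "(b + 1 - a > 0 \<and> b \<le> (N - 2) / 2 \<longrightarrow>
      sqrt (weighted_energy (2 * b) u) * sqrt (weighted_mass (2 * a) u)
        \<ge> \<bar>(N - a - b - 1) / 2\<bar> * weighted_mass (a + b + 1) u \<and>
      (sqrt (weighted_energy (2 * b) u) * sqrt (weighted_mass (2 * a) u)
        = \<bar>(N - a - b - 1) / 2\<bar> * weighted_mass (a + b + 1) u \<longleftrightarrow>
       (\<exists>\<alpha> \<beta>. \<beta> > 0 \<and> (\<forall>x. x \<noteq> 0 \<longrightarrow>
          u x = \<alpha> * exp (- (\<beta> / (b + 1 - a)) * norm x powr (b + 1 - a)))))) \<and>
    (b + 1 - a < 0 \<and> b \<ge> (N - 2) / 2 \<longrightarrow>
      sqrt (weighted_energy (2 * b) u) * sqrt (weighted_mass (2 * a) u)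
        \<ge> \<bar>(a + b + 1 - N) / 2\<bar> * weighted_mass (a + b + 1) u \<and>
      (sqrt (weighted_energy (2 * b) u) * sqrt (weighted_mass (2 * a) u)
        = \<bar>(a + b + 1 - N) / 2\<bar> * weighted_mass (a + b + 1) u \<longleftrightarrow>
       (\<exists>\<alpha> \<beta>. \<beta> > 0 \<and> (\<forall>x. x \<noteq> 0 \<longrightarrow>
          u x = \<alpha> * exp (\<beta> / (b + 1 - a) * norm x powr (b + 1 - a)))))) \<and>
    (b + 1 - a < 0 \<and> b \<le> (N - 2) / 2 \<longrightarrow>
      sqrt (weighted_energy (2 * b) u) * sqrt (weighted_mass (2 * a) u)
        \<ge> \<bar>(N - 3 * b + a - 3) / 2\<bar> * weighted_mass (a + b + 1) u \<and>
      (sqrt (weighted_energy (2 * b) u) * sqrt (weighted_mass (2 * a) u)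
        = \<bar>(N - 3 * b + a - 3) / 2\<bar> * weighted_mass (a + b + 1) u \<longleftrightarrow>
       (\<exists>\<alpha> \<beta>. \<beta> > 0 \<and> (\<forall>x. x \<noteq> 0 \<longrightarrow>
          u x = \<alpha> * norm x powr (2 * b + 2 - N)
                  * exp (\<beta> / (b + 1 - a) * norm x powr (b + 1 - a)))))) \<and>
    (b + 1 - a > 0 \<and> b \<ge> (N - 2) / 2 \<longrightarrow>
      sqrt (weighted_energy (2 * b) u) * sqrt (weighted_mass (2 * a) u)
        \<ge> \<bar>(N - 3 * b + a - 3) / 2\<bar> * weighted_mass (a + b + 1) u \<and>
      (sqrt (weighted_energy (2 * b) u) * sqrt (weighted_mass (2 * a) u)
        = \<bar>(N - 3 * b + a - 3) / 2\<bar> * weighted_mass (a + b + 1) u \<longleftrightarrow>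
       (\<exists>\<alpha> \<beta>. \<beta> > 0 \<and> (\<forall>x. x \<noteq> 0 \<longrightarrow>
          u x = \<alpha> * norm x powr (2 * b + 2 - N)
                  * exp (- (\<beta> / (b + 1 - a)) * norm x powr (b + 1 - a))))))"
proof -
  note profile = nonvanishing_profile_iff_zero[OF u]
  \<comment> \<open>The root \<open>s = 0\<close> serves the first two parts, the root \<open>s = N - 2 - 2b\<close> the last two.\<close>
  have 1: "\<bar>(N - a - b - 1) / 2\<bar> * weighted_mass (a + b + 1) u
      \<le> sqrt (weighted_energy (2 * b) u) * sqrt (weighted_mass (2 * a) u)"
    "sqrt (weighted_energy (2 * b) u) * sqrt (weighted_mass (2 * a) u)
      = \<bar>(N - a - b - 1) / 2\<bar> * weighted_mass (a + b + 1) u \<longleftrightarrow> u = (\<lambda>x. 0)"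
    using weighted_uncertainty[OF u, of 0 b "N - a - b - 1" a] by (simp_all add: N_def)
  have K: "\<bar>(N - 3 * b + a - 3) / 2\<bar> = \<bar>(N - a - b - 1 - 2 * (N - 2 - 2 * b)) / 2\<bar>"
  proof -
    have "N - 3 * b + a - 3 = - (N - a - b - 1 - 2 * (N - 2 - 2 * b))"
      by simp
    then show ?thesis
      by (simp only: minus_divide_left[symmetric] abs_minus_cancel)
  qed
  have 2: "\<bar>(N - 3 * b + a - 3) / 2\<bar> * weighted_mass (a + b + 1) u
      \<le> sqrt (weighted_energy (2 * b) u) * sqrt (weighted_mass (2 * a) u)"
    "sqrt (weighted_energy (2 * b) u) * sqrt (weighted_mass (2 * a) u)
      = \<bar>(N - 3 * b + a - 3) / 2\<bar> * weighted_mass (a + b + 1) u \<longleftrightarrow> u = (\<lambda>x. 0)"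
    unfolding K using weighted_uncertainty[OF u, of "N - 2 - 2 * b" b "N - a - b - 1 - 2 * (N - 2 - 2 * b)" a]
    by (simp_all add: N_def)
  have 3: "\<bar>(a + b + 1 - N) / 2\<bar> = \<bar>(N - a - b - 1) / 2\<bar>"
  proof -
    have "a + b + 1 - N = - (N - a - b - 1)"
      by simp
    then show ?thesis
      by (simp only: minus_divide_left[symmetric] abs_minus_cancel)
  qed
  have p1: "u = (\<lambda>x. 0) \<longleftrightarrow> (\<exists>\<alpha> \<beta>. \<beta> > 0 \<and> (\<forall>x. x \<noteq> 0 \<longrightarrow>
      u x = \<alpha> * exp (- (\<beta> / (b + 1 - a)) * norm x powr (b + 1 - a))))"
    by (rule profile) simp
  have p2: "u = (\<lambda>x. 0) \<longleftrightarrow> (\<exists>\<alpha> \<beta>. \<beta> > 0 \<and> (\<forall>x. x \<noteq> 0 \<longrightarrow>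
      u x = \<alpha> * exp (\<beta> / (b + 1 - a) * norm x powr (b + 1 - a))))"
    by (rule profile) simp
  have p3: "u = (\<lambda>x. 0) \<longleftrightarrow> (\<exists>\<alpha> \<beta>. \<beta> > 0 \<and> (\<forall>x. x \<noteq> 0 \<longrightarrow>
      u x = \<alpha> * norm x powr (2 * b + 2 - N) * exp (\<beta> / (b + 1 - a) * norm x powr (b + 1 - a))))"
    unfolding mult.assoc[of _ "_ powr _"] by (rule profile) simp
  have p4: "u = (\<lambda>x. 0) \<longleftrightarrow> (\<exists>\<alpha> \<beta>. \<beta> > 0 \<and> (\<forall>x. x \<noteq> 0 \<longrightarrow>
      u x = \<alpha> * norm x powr (2 * b + 2 - N) * exp (- (\<beta> / (b + 1 - a)) * norm x powr (b + 1 - a))))"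
    unfolding mult.assoc[of _ "_ powr _"] by (rule profile) simp
  show ?thesis
    unfolding 3
    by (intro conjI impI 1(1) 2(1) trans[OF 1(2) p1] trans[OF 1(2) p2] trans[OF 2(2) p3] trans[OF 2(2) p4])
qed

end
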